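(* Let $M$ be an atomic Puiseux monoid. Then the following statements hold. (1) If $M$ is an MCD-monoid, then $\mathcal{P}_{\mathrm{fin}}(M)$ is atomic. (2) If $M$ is not $2$-MCD, then $\mathcal{P}_{\mathrm{fin}}(M)$ is not atomic.
   Context: All monoids are commutative semigroups with identity, written additively with identity $0$. A Puiseux monoid is a submonoid of $(\mathbb{Q}_{\ge 0},+)$. For a monoid $M$, the (finitary) power monoid $\mathcal{P}_{\mathrm{fin}}(M)$ is the set of all nonempty finite subsets of $M$ with operation $S+T := \{s+t \mid s\in S,\ t\in T\}$; its identity is $\{0\}$. For a monoid $N$, let $N^\times$ be its group of invertible elements. An element $a\in N\setminus N^\times$ is an atom if whenever $a=r+s$ with $r,s\in N$, either $r\in N^\times$ or $s\in N^\times$. The monoid $N$ is atomic if every non-invertible element of $N$ is a finite sum of atoms. For $r,s\in N$, $s$ divides $r$ in $N$ (written $s\mid_N r$) if $r=s+t$ for some $t\in N$. An element $d\in N$ is a maximal common divisor (mcd) of a subset $A\subseteq N$ if $d$ divides every element of $A$ and there is no non-invertible $d'\in N$ such that $d'+d$ divides every element of $A$. For $k\in\mathbb{N}=\{1,2,\dots\}$, $N$ is a $k$-MCD monoid if every subset $A\subseteq N$ with $|A|=k$ has a maximal common divisor in $N$; $N$ is an MCD-monoid if it is $k$-MCD for every $k\in\mathbb{N}$. *)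

theory Defs
  imports "HOL-Algebra.Coset" "HOL-Algebra.Divisibility" "HOL.Rat"
begin

text \<open>
  Monoids are HOL-Algebra monoid records, whose notation is multiplicative: below, \<open>\<otimes>\<close>
  and \<open>\<one>\<close> play the role of addition and \<open>0\<close>, \<open>Units N\<close> is the group of invertible
  elements, and \<open>r divides\<^bsub>N\<^esub> s\<close> is divisibility in the monoid.
\<close>

definition nonneg_rat_monoid :: "rat monoid" where
  "nonneg_rat_monoid = \<lparr>carrier = {q. 0 \<le> q}, mult = (+), one = 0\<rparr>"

definition is_puiseux_monoid :: "rat monoid \<Rightarrow> bool" where
  "is_puiseux_monoid M \<longleftrightarrow>
     (\<exists>H. submonoid H nonneg_rat_monoid \<and> M = nonneg_rat_monoid\<lparr>carrier := H\<rparr>)"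

definition fin_power_monoid :: "('a, 'b) monoid_scheme \<Rightarrow> 'a set monoid" where
  "fin_power_monoid N =
     \<lparr>carrier = {S. S \<subseteq> carrier N \<and> finite S \<and> S \<noteq> {}}, mult = set_mult N, one = {\<one>\<^bsub>N\<^esub>}\<rparr>"

text \<open>
  Not the library's \<open>irreducible\<close>, which is phrased through proper factors and need not
  coincide with this notion in a non-cancellative monoid such as a power monoid.
\<close>

definition is_atom :: "('a, 'b) monoid_scheme \<Rightarrow> 'a \<Rightarrow> bool" where
  "is_atom N a \<longleftrightarrow> a \<in> carrier N - Units N \<and>
     (\<forall>r\<in>carrier N. \<forall>s\<in>carrier N. a = r \<otimes>\<^bsub>N\<^esub> s \<longrightarrow> r \<in> Units N \<or> s \<in> Units N)"

definition is_atomic :: "('a, 'b) monoid_scheme \<Rightarrow> bool" where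
  "is_atomic N \<longleftrightarrow> (\<forall>x\<in>carrier N - Units N.
     \<exists>as. (\<forall>a\<in>set as. is_atom N a) \<and> x = foldr (\<otimes>\<^bsub>N\<^esub>) as \<one>\<^bsub>N\<^esub>)"

definition is_mcd :: "('a, 'b) monoid_scheme \<Rightarrow> 'a set \<Rightarrow> 'a \<Rightarrow> bool" where
  "is_mcd N A d \<longleftrightarrow> d \<in> carrier N \<and> (\<forall>a\<in>A. d divides\<^bsub>N\<^esub> a) \<and>
     \<not> (\<exists>d'\<in>carrier N - Units N. \<forall>a\<in>A. (d' \<otimes>\<^bsub>N\<^esub> d) divides\<^bsub>N\<^esub> a)"

text \<open>
  Meant for \<open>k \<ge> 1\<close> only, where \<open>card A = k\<close> forces \<open>A\<close> to be finite.
\<close>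

definition is_k_MCD :: "nat \<Rightarrow> ('a, 'b) monoid_scheme \<Rightarrow> bool" where
  "is_k_MCD k N \<longleftrightarrow> (\<forall>A. A \<subseteq> carrier N \<and> card A = k \<longrightarrow> (\<exists>d. is_mcd N A d))"

definition is_MCD :: "('a, 'b) monoid_scheme \<Rightarrow> bool" where
  "is_MCD N \<longleftrightarrow> (\<forall>k\<ge>1. is_k_MCD k N)"

end

theory Submission
  imports Defs "HOL-Library.Set_Algebras"
begin

text \<open>
  Everything rests on how cardinality behaves under sums of finite subsets of \<open>\<rat>\<close>: adding a
  singleton is a translation and preserves it, while adding a set with at least two elements
  strictly increases it (\<open>card_less_card_plus\<close>). Singletons in the power monoid are therefore
  a copy of \<open>M\<close> itself, and cardinality bounds all remaining factorizations.

  Part 1. If \<open>d\<close> is an mcd of \<open>S\<close>, then \<open>S = {d} + T\<close>, where \<open>0\<close> is the only common divisor of \<open>T\<close>.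
  The factor \<open>{d}\<close> is a sum of atoms because \<open>M\<close> is atomic. In a decomposition of \<open>T\<close> into
  non-units no summand is a singleton, as its element would be a nonzero common divisor of \<open>T\<close>.
  Hence both summands are smaller than \<open>T\<close>, and they inherit the
  absence of common divisors, so induction on the cardinality splits \<open>T\<close> into atoms.

  Part 2. Let \<open>{a, b}\<close> be a two-element set without an mcd. In a sum of atoms equal to \<open>{a, b}\<close>
  all summands but one are singletons, so \<open>{a, b} = {d} + A\<close> for an atom \<open>A\<close> with two elements.
  Then \<open>d\<close> is a common divisor of \<open>a\<close> and \<open>b\<close> that is not maximal, so some nonzero element
  of \<open>M\<close> divides both elements of \<open>A\<close>. Subtracting it decomposes the atom \<open>A\<close>, a contradiction.
\<close>

section \<open>Cardinality of sums of finite sets\<close>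

lemma card_singleton_plus:
  fixes A :: "'a::cancel_ab_semigroup_add set"
  shows "card ({d} + A) = card A"
proof -
  have "{d} + A = (\<lambda>x. d + x) ` A"
    by (auto simp: set_plus_def)
  then show ?thesis
    by (simp add: card_image)
qed

text \<open>
  The translate of \<open>A\<close> by the least element of \<open>B\<close> misses the sum of the two largest elements.
\<close>

lemma card_less_card_plus:
  fixes A B :: "'a::linordered_cancel_ab_semigroup_add set"
  assumes "finite A" "A \<noteq> {}" "finite B" "card B \<ge> 2"
  shows "card A < card (A + B)"
proof -
  have "B \<noteq> {}"
    using assms(4) by auto
  have "Min B \<noteq> Max B"
  proof
    assume "Min B = Max B"
    then have "B \<subseteq> {Min B}"
      using Min_le[OF assms(3)] Max_ge[OF assms(3)] by (auto intro: order.antisym)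
    then have "card B \<le> 1"
      by (metis card.empty card_mono finite.intros is_singletonI is_singleton_altdef)
    then show False
      using assms(4) by simp
  qed
  then have less: "Min B < Max B"
    using Min_le[OF assms(3) Max_in[OF assms(3) \<open>B \<noteq> {}\<close>]] by simp
  have "Max A + Max B \<notin> {Min B} + A"
  proof
    assume "Max A + Max B \<in> {Min B} + A"
    then obtain x where "x \<in> A" "Max A + Max B = Min B + x"
      by (auto simp: set_plus_def)
    moreover from this have "Min B + x < Max B + Max A"
      using less Max_ge[OF assms(1)] by (intro add_less_le_mono) auto
    ultimately show False
      by (simp add: add.commute)
  qed
  moreover have "Max A + Max B \<in> A + B"
    using assms \<open>B \<noteq> {}\<close> by (intro set_plus_intro Max_in)
  moreover have "{Min B} + A \<subseteq> A + B"
    using Min_in[OF assms(3) \<open>B \<noteq> {}\<close>] by (auto simp: set_plus_def add.commute)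
  ultimately have "card ({Min B} + A) < card (A + B)"
    using assms(1,3) by (intro psubset_card_mono) (auto simp: finite_set_plus)
  then show ?thesis
    by (simp add: card_singleton_plus)
qed

section \<open>Puiseux monoids and their power monoids\<close>

context
  fixes M :: "rat monoid"
  assumes puiseux: "is_puiseux_monoid M"
begin

lemma
  shows mult_puiseux: "mult M = (+)"
    and one_puiseux: "one M = 0"
    and nonneg_puiseux: "x \<in> carrier M \<Longrightarrow> 0 \<le> x"
    and zero_in_puiseux: "0 \<in> carrier M"
    and add_in_puiseux: "x \<in> carrier M \<Longrightarrow> y \<in> carrier M \<Longrightarrow> x + y \<in> carrier M"
  using puiseux by (auto simp: is_puiseux_monoid_def nonneg_rat_monoid_def submonoid_def)

lemma Units_puiseux: "Units M = {0}"
  using nonneg_puiseux zero_in_puiseux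
  by (auto simp: Units_def mult_puiseux one_puiseux add_nonneg_eq_0_iff)

lemma divides_puiseux: "d divides\<^bsub>M\<^esub> a \<longleftrightarrow> a - d \<in> carrier M"
  unfolding factor_def mult_puiseux by (auto simp: algebra_simps intro!: bexI[of _ "a - d"])

lemma is_atom_puiseux:
  "is_atom M a \<longleftrightarrow> a \<in> carrier M \<and> a \<noteq> 0 \<and>
     (\<forall>r\<in>carrier M. \<forall>s\<in>carrier M. a = r + s \<longrightarrow> r = 0 \<or> s = 0)"
  by (auto simp: is_atom_def Units_puiseux mult_puiseux)

lemma is_mcd_puiseux:
  "is_mcd M A d \<longleftrightarrow> d \<in> carrier M \<and> (\<forall>a\<in>A. a - d \<in> carrier M) \<and>
     (\<forall>e\<in>carrier M. (\<forall>a\<in>A. a - d - e \<in> carrier M) \<longrightarrow> e = 0)"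
  by (auto simp: is_mcd_def divides_puiseux Units_puiseux mult_puiseux algebra_simps)

lemma is_atomic_puiseux:
  "is_atomic M \<longleftrightarrow> (\<forall>x\<in>carrier M - {0}. \<exists>as. (\<forall>a\<in>set as. is_atom M a) \<and> x = sum_list as)"
  by (simp add: is_atomic_def Units_puiseux mult_puiseux one_puiseux sum_list.eq_foldr)

lemma carrier_power:
  "S \<in> carrier (fin_power_monoid M) \<longleftrightarrow> S \<subseteq> carrier M \<and> finite S \<and> S \<noteq> {}"
  by (simp add: fin_power_monoid_def)

lemma mult_power: "mult (fin_power_monoid M) = (+)"
  by (auto simp: fin_power_monoid_def set_mult_def mult_puiseux set_plus_def fun_eq_iff)

lemma one_power: "one (fin_power_monoid M) = 0"
  by (simp add: fin_power_monoid_def one_puiseux)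

lemma zero_in_power: "0 \<in> carrier (fin_power_monoid M)"
  using zero_in_puiseux by (simp add: carrier_power)

lemma singleton_in_power: "x \<in> carrier M \<Longrightarrow> {x} \<in> carrier (fin_power_monoid M)"
  by (simp add: carrier_power)

lemma add_in_power:
  assumes "S \<in> carrier (fin_power_monoid M)" "T \<in> carrier (fin_power_monoid M)"
  shows "S + T \<in> carrier (fin_power_monoid M)"
  using assms add_in_puiseux
  by (auto simp: carrier_power finite_set_plus subset_iff set_plus_def)

lemma card_power_pos: "S \<in> carrier (fin_power_monoid M) \<Longrightarrow> card S \<ge> 1"
  by (simp add: carrier_power Suc_le_eq card_gt_0_iff)

lemma card_less_card_plus_power:
  assumes "S \<in> carrier (fin_power_monoid M)" "T \<in> carrier (fin_power_monoid M)" "card T \<ge> 2"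
  shows "card S < card (S + T)"
  using assms by (intro card_less_card_plus) (auto simp: carrier_power)

lemma zero_sum_power:
  assumes "S \<in> carrier (fin_power_monoid M)" "T \<in> carrier (fin_power_monoid M)" "S + T = 0"
  shows "S = 0"
proof -
  have "x = 0" if x: "x \<in> S" for x
  proof -
    obtain y where y: "y \<in> T"
      using assms(2) by (auto simp: carrier_power)
    have "x + y = 0"
      using set_plus_intro[OF x y] assms(3) by simp
    moreover have "0 \<le> x" "0 \<le> y"
      using x y assms(1,2) nonneg_puiseux by (auto simp: carrier_power)
    ultimately show ?thesis
      by (simp add: add_nonneg_eq_0_iff)
  qed
  then show ?thesis
    using assms(1) by (auto simp: carrier_power)
qed

lemma Units_power: "Units (fin_power_monoid M) = {0}"
proof
  show "Units (fin_power_monoid M) \<subseteq> {0}"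
    using zero_sum_power by (auto simp: Units_def mult_power one_power)
  show "{0} \<subseteq> Units (fin_power_monoid M)"
    using zero_in_power by (auto simp: Units_def mult_power one_power intro!: bexI[of _ 0])
qed

lemma is_atom_power:
  "is_atom (fin_power_monoid M) A \<longleftrightarrow> A \<in> carrier (fin_power_monoid M) \<and> A \<noteq> 0 \<and>
     (\<forall>R\<in>carrier (fin_power_monoid M). \<forall>S\<in>carrier (fin_power_monoid M).
        A = R + S \<longrightarrow> R = 0 \<or> S = 0)"
  by (auto simp: is_atom_def Units_power mult_power)

lemma is_atomic_power:
  "is_atomic (fin_power_monoid M) \<longleftrightarrow> (\<forall>S\<in>carrier (fin_power_monoid M) - {0}.
     \<exists>As. (\<forall>A\<in>set As. is_atom (fin_power_monoid M) A) \<and> S = sum_list As)"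
  by (simp add: is_atomic_def Units_power mult_power one_power sum_list.eq_foldr)

section \<open>Atomicity of the power monoid of an MCD-monoid\<close>

text \<open>
  A sum of nonempty sets is a singleton only if both summands are, so singletons
  decompose exactly as their elements do.
\<close>

lemma is_atom_singleton:
  assumes "is_atom M a"
  shows "is_atom (fin_power_monoid M) {a}"
  unfolding is_atom_power
proof (intro conjI ballI impI)
  show "{a} \<in> carrier (fin_power_monoid M)" "{a} \<noteq> 0"
    using assms by (auto simp: is_atom_puiseux carrier_power set_zero)
next
  fix R S
  assume R: "R \<in> carrier (fin_power_monoid M)" and S: "S \<in> carrier (fin_power_monoid M)"
    and eq: "{a} = R + S"
  have "\<not> card S \<ge> 2" "\<not> card R \<ge> 2"
    using card_less_card_plus_power[OF R S] card_less_card_plus_power[OF S R]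
      card_power_pos[OF R] card_power_pos[OF S]
    by (auto simp: add.commute[of S R] eq[symmetric])
  then have "card R = 1" "card S = 1"
    using card_power_pos[OF R] card_power_pos[OF S] by auto
  then obtain r s where rs: "R = {r}" "S = {s}"
    by (auto simp: card_1_singleton_iff)
  then have "a = r + s"
    using eq by (simp add: set_plus_def)
  then show "R = 0 \<or> S = 0"
    using assms R S rs by (auto simp: is_atom_puiseux carrier_power set_zero)
qed

lemma singleton_sum_list: "{sum_list (as :: rat list)} = sum_list (map (\<lambda>a. {a}) as)"
  by (induction as) (auto simp: set_plus_def simp flip: set_zero)

text \<open>
  The hypothesis says that \<open>0\<close> is an mcd of \<open>S\<close>. It passes to every summand of \<open>S\<close>,
  and it excludes singleton summands other than \<open>{0}\<close>; so
  both summands in a nontrivial decomposition have fewer elements than \<open>S\<close>.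
\<close>

lemma sum_of_atoms_if_mcd_zero:
  assumes "S \<in> carrier (fin_power_monoid M)" "is_mcd M S 0"
  shows "\<exists>As. (\<forall>A\<in>set As. is_atom (fin_power_monoid M) A) \<and> S = sum_list As"
  using assms
proof (induction "card S" arbitrary: S rule: less_induct)
  case less
  note S = less.prems(1)
  have proper_summand: "is_mcd M R 0 \<and> card R \<ge> 2"
    if R: "R \<in> carrier (fin_power_monoid M)" and T: "T \<in> carrier (fin_power_monoid M)"
      and eq: "S = R + T" and "R \<noteq> 0" for R T
  proof
    have common: "e = 0" if e: "e \<in> carrier M" "\<forall>x\<in>R. x - e \<in> carrier M" for e
    proof -
      have "x - e \<in> carrier M" if "x \<in> S" for x
      proof -
        obtain r t where "r \<in> R" "t \<in> T" "x = r + t"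
          using \<open>x \<in> S\<close> by (auto simp: eq elim: set_plus_elim)
        then have "(r - e) + t \<in> carrier M"
          using e(2) T by (intro add_in_puiseux) (auto simp: carrier_power)
        then show ?thesis
          by (simp add: \<open>x = r + t\<close> algebra_simps)
      qed
      then show ?thesis
        using less.prems(2) e(1) by (simp add: is_mcd_puiseux)
    qed
    then show "is_mcd M R 0"
      using R zero_in_puiseux by (auto simp: is_mcd_puiseux carrier_power)
    have "card R \<noteq> 1"
    proof
      assume "card R = 1"
      then obtain r where "R = {r}"
        by (auto simp: card_1_singleton_iff)
      then show False
        using common[of r] R zero_in_puiseux \<open>R \<noteq> 0\<close> by (auto simp: carrier_power set_zero)
    qed
    then show "card R \<ge> 2"
      using card_power_pos[OF R] by linarith
  qed
  consider "S = 0" | "is_atom (fin_power_monoid M) S"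
    | R T where "R \<in> carrier (fin_power_monoid M)" "T \<in> carrier (fin_power_monoid M)"
        "S = R + T" "R \<noteq> 0" "T \<noteq> 0"
    using S by (auto simp: is_atom_power)
  then show ?case
  proof cases
    case 1
    then show ?thesis
      by (intro exI[of _ "[]"]) simp
  next
    case 2
    then show ?thesis
      by (intro exI[of _ "[S]"]) simp
  next
    case (3 R T)
    have R: "is_mcd M R 0 \<and> card R \<ge> 2"
      using proper_summand[of R T] 3 by blast
    have T: "is_mcd M T 0 \<and> card T \<ge> 2"
      using proper_summand[of T R] 3 by (simp add: add.commute)
    have "card R < card S" "card T < card S"
      using card_less_card_plus_power[of R T] card_less_card_plus_power[of T R] R T 3
      by (auto simp: add.commute)
    then obtain As Bs where "\<forall>A\<in>set As. is_atom (fin_power_monoid M) A" "R = sum_list As"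
        "\<forall>A\<in>set Bs. is_atom (fin_power_monoid M) A" "T = sum_list Bs"
      using less.hyps R T 3 by meson
    then show ?thesis
      using 3 by (intro exI[of _ "As @ Bs"]) auto
  qed
qed

lemma is_atomic_power_if_is_MCD:
  assumes atomic: "is_atomic M" and MCD: "is_MCD M"
  shows "is_atomic (fin_power_monoid M)"
  unfolding is_atomic_power
proof
  fix S assume "S \<in> carrier (fin_power_monoid M) - {0}"
  then have S: "S \<in> carrier (fin_power_monoid M)"
    by simp
  then obtain d where d: "is_mcd M S d"
    using MCD card_power_pos[OF S] unfolding is_MCD_def is_k_MCD_def carrier_power by blast
  define T where "T = (\<lambda>x. x - d) ` S"
  have T: "T \<in> carrier (fin_power_monoid M)" "is_mcd M T 0"
    using d S zero_in_puiseux by (auto simp: T_def carrier_power is_mcd_puiseux)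
  have eq: "S = {d} + T"
    by (auto simp: T_def set_plus_def)
  obtain Bs where Bs: "\<forall>A\<in>set Bs. is_atom (fin_power_monoid M) A" "T = sum_list Bs"
    using sum_of_atoms_if_mcd_zero[OF T] by blast
  obtain as where as: "\<forall>a\<in>set as. is_atom M a" "d = sum_list as"
  proof (cases "d = 0")
    case True
    then show ?thesis
      using that[of "[]"] by simp
  next
    case False
    then show ?thesis
      using that atomic d unfolding is_atomic_puiseux is_mcd_puiseux by blast
  qed
  have "\<forall>A\<in>set (map (\<lambda>a. {a}) as @ Bs). is_atom (fin_power_monoid M) A"
    using as(1) Bs(1) is_atom_singleton by auto
  moreover have "S = sum_list (map (\<lambda>a. {a}) as @ Bs)"
    using eq as(2) Bs(2) by (simp add: singleton_sum_list)
  ultimately show "\<exists>As. (\<forall>A\<in>set As. is_atom (fin_power_monoid M) A) \<and> S = sum_list As"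
    by blast
qed

section \<open>Two-element sets without a maximal common divisor\<close>

text \<open>
  Two summands with at least two elements each would give a sum with at least three; so at most one
  summand is not a singleton, and the singletons add up to \<open>{d}\<close>.
\<close>

lemma two_element_sum_of_atoms:
  assumes "\<forall>A\<in>set As. is_atom (fin_power_monoid M) A" "card (sum_list As) = 2"
  shows "\<exists>d\<in>carrier M. \<exists>A. is_atom (fin_power_monoid M) A \<and> card A = 2 \<and> sum_list As = {d} + A"
  using assms
proof (induction As)
  case Nil
  then show ?case
    by (simp add: set_zero)
next
  case (Cons B Bs)
  have in_power: "sum_list Cs \<in> carrier (fin_power_monoid M)"
    if "\<forall>A\<in>set Cs. is_atom (fin_power_monoid M) A" for Cs
    using that
    by (induction Cs) (auto simp: singleton_in_power zero_in_puiseux is_atom_power intro: add_in_power)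
  have B: "B \<in> carrier (fin_power_monoid M)"
    using Cons.prems(1) by (simp add: is_atom_power)
  have Bs: "sum_list Bs \<in> carrier (fin_power_monoid M)"
    using in_power Cons.prems(1) by simp
  show ?case
  proof (cases "card B = 1")
    case True
    then obtain b where b: "B = {b}"
      by (auto simp: card_1_singleton_iff)
    then have "card (sum_list Bs) = 2"
      using Cons.prems(2) by (simp add: card_singleton_plus)
    then obtain d A where dA: "d \<in> carrier M" "is_atom (fin_power_monoid M) A" "card A = 2"
        "sum_list Bs = {d} + A"
      using Cons.IH Cons.prems(1) by auto
    have "sum_list (B # Bs) = ({b} + {d}) + A"
      by (simp add: b dA(4) add.assoc)
    also have "{b} + {d} = {b + d}"
      by (simp add: set_plus_def)
    finally show ?thesis
      using dA B b add_in_puiseux by (auto simp: carrier_power)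
  next
    case False
    then have "card B \<ge> 2"
      using card_power_pos[OF B] by linarith
    then have "card (sum_list Bs) < 2"
      using card_less_card_plus_power[OF Bs B] Cons.prems(2) by (simp add: add.commute)
    then have "card (sum_list Bs) = 1"
      using card_power_pos[OF Bs] by linarith
    then obtain d where d: "sum_list Bs = {d}"
      by (auto simp: card_1_singleton_iff)
    then have eq: "sum_list (B # Bs) = {d} + B"
      by (simp add: add.commute)
    then have "card B = 2"
      using Cons.prems(2) by (metis card_singleton_plus)
    then show ?thesis
      using eq d Bs Cons.prems(1) by (auto simp: carrier_power)
  qed
qed

lemma not_is_atomic_power_if_not_2_MCD:
  assumes "\<not> is_k_MCD 2 M"
  shows "\<not> is_atomic (fin_power_monoid M)"
proof
  assume atomic: "is_atomic (fin_power_monoid M)"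
  obtain S where S: "S \<subseteq> carrier M" "card S = 2" and no_mcd: "\<And>d. \<not> is_mcd M S d"
    using assms by (auto simp: is_k_MCD_def)
  have "finite S" "S \<noteq> {}"
    using S(2) by (auto intro: card_ge_0_finite)
  then have "S \<in> carrier (fin_power_monoid M) - {0}"
    using S by (auto simp: carrier_power set_zero)
  then obtain As where As: "\<forall>A\<in>set As. is_atom (fin_power_monoid M) A" "S = sum_list As"
    using atomic unfolding is_atomic_power by blast
  then obtain d A where d: "d \<in> carrier M" and A: "is_atom (fin_power_monoid M) A" "card A = 2"
      and eq: "S = {d} + A"
    using two_element_sum_of_atoms[OF As(1)] S(2) by auto
  have A_in: "A \<in> carrier (fin_power_monoid M)"
    using A by (simp add: is_atom_power)
  have "\<forall>x\<in>S. x - d \<in> carrier M"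
    using A_in by (auto simp: eq set_plus_def carrier_power)
  then obtain e where e: "e \<in> carrier M" "e \<noteq> 0" "\<forall>x\<in>S. x - d - e \<in> carrier M"
    using no_mcd[of d] d by (auto simp: is_mcd_puiseux)
  define B where "B = (\<lambda>x. x - e) ` A"
  have split: "A = {e} + B"
    by (auto simp: B_def set_plus_def)
  have B: "B \<in> carrier (fin_power_monoid M)"
    using e(3) A_in by (auto simp: B_def carrier_power eq set_plus_def)
  have "card B = 2"
    using A(2) split by (simp add: card_singleton_plus)
  then have "B \<noteq> 0"
    by (auto simp: set_zero)
  moreover have "{e} \<noteq> 0"
    using e(2) by (simp add: set_zero)
  ultimately show False
    using A(1) split B singleton_in_power[OF e(1)] by (auto simp: is_atom_power)
qed

end

theorem theorem3p2:
  fixes M :: "rat monoid"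
  assumes "is_puiseux_monoid M" and "is_atomic M"
  shows "(is_MCD M \<longrightarrow> is_atomic (fin_power_monoid M)) \<and>
    (\<not> is_k_MCD 2 M \<longrightarrow> \<not> is_atomic (fin_power_monoid M))"
  using is_atomic_power_if_is_MCD[OF assms] not_is_atomic_power_if_not_2_MCD[OF assms(1)]
  by blast

end
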